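(* Let $p$ be an odd prime and let $a,b\in\mathbb{Z}$. Then $$\sum_{k=0}^{\frac{p-1}{2}}\binom{p-1}{k}\binom{2k}{k}^2\frac{V_k(a,b)}{16^k}\equiv(-1)^{\frac{p-1}{2}}16^{p-1}\sum_{j=0}^{\frac{p-1}{2}}\binom{\frac{p-1}{2}}{j}^2V_j(a+2,a+b+1)(1+2pH_{2j})\pmod{p^2}.$$ Furthermore, if $p^2$ does not divide $a^2-4b$, then $$\sum_{k=0}^{\frac{p-1}{2}}\binom{p-1}{k}\binom{2k}{k}^2\frac{U_k(a,b)}{16^k}\equiv(-1)^{\frac{p-1}{2}}16^{p-1}\sum_{j=0}^{\frac{p-1}{2}}\binom{\frac{p-1}{2}}{j}^2U_j(a+2,a+b+1)(1+2pH_{2j})\pmod{p^2}.$$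
   Context: For integers $a,b$ the Lucas sequences are defined by $U_0(a,b)=0$, $U_1(a,b)=1$, $U_n(a,b)=aU_{n-1}(a,b)-bU_{n-2}(a,b)$ for $n\ge 2$, and $V_0(a,b)=2$, $V_1(a,b)=a$, $V_n(a,b)=aV_{n-1}(a,b)-bV_{n-2}(a,b)$ for $n\ge 2$. The harmonic numbers are $H_n=\sum_{k=1}^n\frac1k$, with $H_0=0$. Congruences are between rational numbers whose denominators are prime to $p$: for such $r,s$, $r\equiv s\pmod{p^2}$ means that the numerator of $r-s$ in lowest terms is divisible by $p^2$. *)

theory Defs
  imports Complex_Main "HOL-Number_Theory.Number_Theory"
begin

fun lucas_U :: "int \<Rightarrow> int \<Rightarrow> nat \<Rightarrow> int" where
  "lucas_U a b 0 = 0"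
| "lucas_U a b (Suc 0) = 1"
| "lucas_U a b (Suc (Suc n)) = a * lucas_U a b (Suc n) - b * lucas_U a b n"

fun lucas_V :: "int \<Rightarrow> int \<Rightarrow> nat \<Rightarrow> int" where
  "lucas_V a b 0 = 2"
| "lucas_V a b (Suc 0) = a"
| "lucas_V a b (Suc (Suc n)) = a * lucas_V a b (Suc n) - b * lucas_V a b n"

text \<open>The library's harmonic numbers \<open>harm\<close> live in real normed fields, which
  excludes \<^typ>\<open>rat\<close>, where the congruences take place.\<close>

definition harmonic :: "nat \<Rightarrow> rat" where
  "harmonic n = (\<Sum>k = 1..n. 1 / of_nat k)"

text \<open>\<^term>\<open>quotient_of r\<close> is the pair (numerator, positive denominator) of \<open>r\<close> in lowest terms.
  The side condition that both denominators are prime to \<open>p\<close> is part of the relation.\<close>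

definition rat_cong_p2 :: "nat \<Rightarrow> rat \<Rightarrow> rat \<Rightarrow> bool" where
  "rat_cong_p2 p r s \<longleftrightarrow>
     coprime (snd (quotient_of r)) (int p) \<and>
     coprime (snd (quotient_of s)) (int p) \<and>
     (int p)\<^sup>2 dvd fst (quotient_of (r - s))"

end

theory Submission
  imports Defs "HOL-Computational_Algebra.Polynomial" "HOL-Computational_Algebra.Formal_Power_Series"
begin

text \<open>
  Put \<open>n = (p - 1) div 2\<close>. The maps \<open>x^k \<mapsto> U\<^sub>k(a, b)\<close> and \<open>x^k \<mapsto> V\<^sub>k(a, b)\<close>, extended linearly
  to polynomials, send \<open>(1 + x)^j\<close> to \<open>U\<^sub>j(a + 2, a + b + 1)\<close> and \<open>V\<^sub>j(a + 2, a + b + 1)\<close>, so it suffices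
  to compare the coefficients of \<open>x^k\<close> modulo \<open>p\<^sup>2\<close>. Both turn out to be congruent to
  \<open>(1 - p H\<^sub>k) (n choose k) ((n + k) choose k)\<close>. On the left this uses
  \<open>((2 k) choose k)\<^sup>2 / 16^k \<equiv> (-1)^k (n choose k) ((n + k) choose k)\<close>. On the right,
  \<open>2 H\<^sub>2\<^sub>j \<equiv> H\<^sub>j + H\<^sub>n\<^sub>-\<^sub>j - H\<^sub>n\<close> modulo \<open>p\<close>, and the resulting sum over \<open>j\<close> of products of two binomial
  coefficients with harmonic numbers is evaluated by differentiating Vandermonde's identity.
\<close>

section \<open>Binomial transforms of Lucas sequences\<close>

text \<open>Pascal's rule: with \<open>E\<close> the shift of sequences, the transform at
  \<open>j\<close> is \<open>(1 + E)^j\<close> applied to \<open>f\<close> and evaluated at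
  0.\<close>

lemma binomial_transform_Suc:
  fixes f :: "nat \<Rightarrow> 'a :: comm_semiring_1"
  shows "(\<Sum>k\<le>Suc j. of_nat (Suc j choose k) * f k) =
    (\<Sum>k\<le>j. of_nat (j choose k) * f k) + (\<Sum>k\<le>j. of_nat (j choose k) * f (Suc k))"
proof -
  have "(\<Sum>k\<le>Suc j. of_nat (Suc j choose k) * f k) =
      f 0 + (\<Sum>k\<le>j. of_nat (j choose Suc k) * f (Suc k)) + (\<Sum>k\<le>j. of_nat (j choose k) * f (Suc k))"
    by (subst sum.atMost_Suc_shift) (simp add: algebra_simps sum.distrib)
  also have "f 0 + (\<Sum>k\<le>j. of_nat (j choose Suc k) * f (Suc k)) = (\<Sum>k\<le>Suc j. of_nat (j choose k) * f k)"
    by (subst sum.atMost_Suc_shift) simp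
  finally show ?thesis by (simp add: binomial_eq_0)
qed

text \<open>If \<open>E^2 = a E - b\<close>, then \<open>F = 1 + E\<close> satisfies
  \<open>F^2 = (a + 2) F - (a + b + 1)\<close>.\<close>

lemma binomial_transform_recurrence:
  fixes f :: "nat \<Rightarrow> int"
  assumes rec: "\<And>k. f (Suc (Suc k)) = a * f (Suc k) - b * f k"
  defines "g \<equiv> \<lambda>j. \<Sum>k\<le>j. of_nat (j choose k) * f k"
  shows "g (Suc (Suc j)) = (a + 2) * g (Suc j) - (a + b + 1) * g j"
proof -
  have "(\<Sum>k\<le>j. of_nat (j choose k) * f (Suc (Suc k))) =
      a * (\<Sum>k\<le>j. of_nat (j choose k) * f (Suc k)) - b * (\<Sum>k\<le>j. of_nat (j choose k) * f k)"
    unfolding rec by (simp add: algebra_simps sum_subtractf sum_distrib_left)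
  then show ?thesis
    unfolding g_def binomial_transform_Suc by (simp add: algebra_simps)
qed

lemma lucas_U_binomial_transform:
  "lucas_U (a + 2) (a + b + 1) j = (\<Sum>k\<le>j. of_nat (j choose k) * lucas_U a b k)"
proof (induction j rule: induct_nat_012)
  case (ge2 j)
  then show ?case
    using binomial_transform_recurrence[of "lucas_U a b" a b j] by simp
qed auto

lemma lucas_V_binomial_transform:
  "lucas_V (a + 2) (a + b + 1) j = (\<Sum>k\<le>j. of_nat (j choose k) * lucas_V a b k)"
proof (induction j rule: induct_nat_012)
  case (ge2 j)
  then show ?case
    using binomial_transform_recurrence[of "lucas_V a b" a b j] by simp
qed auto

section \<open>Harmonic numbers and binomial coefficients\<close>

lemma harmonic_0 [simp]: "harmonic 0 = 0"
  by (simp add: harmonic_def)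

lemma harmonic_Suc: "harmonic (Suc n) = harmonic n + 1 / of_nat (Suc n)"
  by (simp add: harmonic_def)

lemma harmonic_diff: "harmonic (k + n) - harmonic k = (\<Sum>i<n. 1 / of_nat (k + Suc i))"
  by (induction n) (simp_all add: harmonic_Suc)

lemma of_nat_binomial_Suc:
  "of_nat (n choose Suc k) = of_nat (n - k) / of_nat (Suc k) * (of_nat (n choose k) :: rat)"
proof -
  have "of_nat (Suc k) * of_nat (n choose Suc k) = of_nat (n - k) * (of_nat (n choose k) :: rat)"
    unfolding of_nat_mult[symmetric] by (simp only: binomial_absorb_comp binomial_absorption)
  then show ?thesis by (simp add: field_simps del: of_nat_Suc)
qed

lemma of_nat_Suc_binomial_Suc:
  "of_nat (Suc n choose Suc k) = of_nat (Suc n) / of_nat (Suc k) * (of_nat (n choose k) :: rat)"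
proof -
  have "of_nat (Suc k) * of_nat (Suc n choose Suc k) = of_nat (Suc n) * (of_nat (n choose k) :: rat)"
    unfolding of_nat_mult[symmetric] by (simp only: Suc_times_binomial)
  then show ?thesis by (simp add: field_simps del: of_nat_Suc binomial_Suc_Suc)
qed

lemma of_nat_binomial_eq_prod:
  "of_nat (n choose k) = (\<Prod>i<k. of_nat (n - i) / of_nat (Suc i) :: rat)"
  by (induction k) (simp_all add: of_nat_binomial_Suc del: of_nat_Suc)

text \<open>Coefficient 1 is the derivative at 0, so the second claim is the logarithmic derivative
  of the product.\<close>

lemma coeff_1_prod_linear:
  fixes c :: "nat \<Rightarrow> rat"
  assumes "\<And>i. i < j \<Longrightarrow> c i \<noteq> 0"
  shows "coeff (\<Prod>i<j. [:c i, 1:]) 0 = (\<Prod>i<j. c i)"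
    and "coeff (\<Prod>i<j. [:c i, 1:]) 1 = (\<Prod>i<j. c i) * (\<Sum>i<j. 1 / c i)"
  using assms by (induction j) (auto simp: coeff_mult_0 field_simps)

text \<open>The derivative in \<open>y\<close>, at \<open>y = n\<close>, of Vandermonde's identity for \<open>(y + m) choose r\<close>.\<close>

lemma Vandermonde_harmonic:
  assumes "r \<le> n"
  shows "(\<Sum>j\<le>r. of_nat ((n choose j) * (m choose (r - j))) * (harmonic n - harmonic (n - j))) =
    of_nat ((n + m) choose r) * (harmonic (n + m) - harmonic (n + m - r))"
proof -
  \<comment> \<open>\<open>B N j\<close> is the polynomial \<open>(N + t) choose j\<close> in
    \<open>t\<close>. For \<open>j \<le> N\<close> no subtraction \<open>N - i\<close> truncates and
    every constant term is nonzero.\<close>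
  define B :: "nat \<Rightarrow> nat \<Rightarrow> rat poly" where
    "B N j = smult (1 / fact j) (\<Prod>i<j. [:of_nat (N - i), 1:])" for N j
  have poly_B: "poly (B N j) t = (of_nat N + t) gchoose j" if "j \<le> N" for N j t
    using that by (simp add: B_def gbinomial_prod_rev poly_prod of_nat_diff atLeast0LessThan
        algebra_simps cong: prod.cong_simp)
  have coeff_B: "coeff (B N j) (Suc 0) = of_nat (N choose j) * (harmonic N - harmonic (N - j))"
    if "j \<le> N" for N j
  proof -
    have "harmonic N - harmonic (N - j) = (\<Sum>i<j. 1 / of_nat (N - i))"
      using harmonic_diff[of "N - j" j] that
      by (subst sum.nat_diff_reindex[symmetric]) (auto intro!: sum.cong)
    moreover have "of_nat (N choose j) = (\<Prod>i<j. of_nat (N - i)) / (fact j :: rat)"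
      using of_nat_binomial_eq_prod[of N j]
      by (simp add: prod_dividef fact_prod_Suc atLeast0LessThan)
    ultimately show ?thesis
      using that coeff_1_prod_linear(2)[of j "\<lambda>i. of_nat (N - i)"] by (simp add: B_def)
  qed
  \<comment> \<open>Vandermonde's identity holds at every rational \<open>t\<close>, hence between
    polynomials; the coefficients of \<open>t\<close> can then be compared.\<close>
  have "(\<Sum>j\<le>r. smult (of_nat (m choose (r - j))) (B n j)) = B (n + m) r"
  proof (subst poly_eq_poly_eq_iff[symmetric], rule ext)
    fix t
    have "poly (\<Sum>j\<le>r. smult (of_nat (m choose (r - j))) (B n j)) t =
        (\<Sum>j\<le>r. ((of_nat n + t) gchoose j) * (of_nat m gchoose (r - j)))"
      using assms by (simp add: poly_sum poly_B binomial_gbinomial mult.commute)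
    also have "\<dots> = (of_nat n + t + of_nat m) gchoose r"
      using gbinomial_Vandermonde[of "of_nat n + t" "of_nat m" r] by (simp add: atMost_atLeast0)
    finally show "poly (\<Sum>j\<le>r. smult (of_nat (m choose (r - j))) (B n j)) t = poly (B (n + m) r) t"
      using assms by (simp add: poly_B algebra_simps)
  qed
  then have "(\<Sum>j\<le>r. of_nat (m choose (r - j)) * coeff (B n j) (Suc 0)) = coeff (B (n + m) r) (Suc 0)"
    by (metis (no_types, lifting) coeff_smult coeff_sum sum.cong)
  then show ?thesis
    using assms by (simp add: coeff_B algebra_simps)
qed

text \<open>The two harmonic numbers are handled separately: \<open>harmonic (n - j)\<close>
  directly by the differentiated identity, \<open>harmonic j\<close> by the same identity after the
  reversal \<open>j \<mapsto> n - j\<close>.\<close>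

lemma Vandermonde_harmonic_sum:
  assumes "k \<le> n"
  shows "(\<Sum>j\<le>n. of_nat ((n choose j) * ((n - k) choose (n - j))) * (harmonic j + harmonic (n - j))) =
    of_nat ((2 * n - k) choose n) * (3 * harmonic n - 2 * harmonic (2 * n - k) + harmonic (n - k))"
proof -
  define w :: "nat \<Rightarrow> rat" where "w j = of_nat ((n choose j) * ((n - k) choose (n - j)))" for j
  define W :: rat where "W = of_nat ((2 * n - k) choose n)"
  have n: "n + (n - k) = 2 * n - k" "2 * n - k - n = n - k" "2 * n - k - (n - k) = n"
    using assms by auto
  have sum_w: "(\<Sum>j\<le>n. w j) = W"
    using vandermonde[of n "n - k" n] n unfolding w_def W_def of_nat_sum[symmetric] by simp
  have 1: "(\<Sum>j\<le>n. w j * (harmonic n - harmonic (n - j))) = W * (harmonic (2 * n - k) - harmonic (n - k))"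
    using Vandermonde_harmonic[of n n "n - k"] n by (simp add: w_def W_def)
  have "(\<Sum>j\<le>n. w j * (harmonic n - harmonic j)) = (\<Sum>j\<le>n. w (n - j) * (harmonic n - harmonic (n - j)))"
    by (simp add: atMost_atLeast0, subst sum.atLeastAtMost_rev) (auto intro!: sum.cong)
  \<comment> \<open>After reversal the second binomial coefficient is
    \<open>(n - k) choose j\<close>, which vanishes for \<open>j > n - k\<close>; so the sum is a
    Vandermonde sum with \<open>r = n - k\<close>.\<close>
  also have "\<dots> = (\<Sum>j\<le>n - k. of_nat ((n choose j) * ((n - k) choose (n - k - j))) * (harmonic n - harmonic (n - j)))"
  proof (rule sum.mono_neutral_cong_right)
    fix j assume "j \<in> {..n - k}"
    then show "w (n - j) * (harmonic n - harmonic (n - j)) =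
        of_nat ((n choose j) * ((n - k) choose (n - k - j))) * (harmonic n - harmonic (n - j))"
      using binomial_symmetric[of j n] binomial_symmetric[of j "n - k"] by (simp add: w_def)
  qed (auto simp: w_def)
  also have "\<dots> = W * (harmonic (2 * n - k) - harmonic n)"
    using Vandermonde_harmonic[of "n - k" n "n - k"] n assms binomial_symmetric[of n "2 * n - k"]
    by (simp add: W_def)
  finally have 2: "(\<Sum>j\<le>n. w j * (harmonic n - harmonic j)) = W * (harmonic (2 * n - k) - harmonic n)" .
  have "(\<Sum>j\<le>n. w j * (harmonic j + harmonic (n - j))) = 2 * harmonic n * (\<Sum>j\<le>n. w j)
      - (\<Sum>j\<le>n. w j * (harmonic n - harmonic j)) - (\<Sum>j\<le>n. w j * (harmonic n - harmonic (n - j)))"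
    by (simp add: sum_distrib_left sum_subtractf[symmetric] algebra_simps)
  then show ?thesis
    unfolding w_def[symmetric] W_def[symmetric] 1 2 sum_w by (simp add: algebra_simps)
qed

section \<open>Congruences in the localization of the integers at a prime\<close>

locale localization =
  fixes p :: nat
  assumes prime: "prime p"
begin

text \<open>Membership in the localization of the integers at \<open>p\<close>, phrased through
  \<open>quotient_of\<close> to match \<open>rat_cong_p2\<close>.\<close>

definition integral :: "rat \<Rightarrow> bool" where
  "integral r \<longleftrightarrow> coprime (snd (quotient_of r)) (int p)"

text \<open>The denominator in lowest terms divides every other denominator, so the fraction need
  not be reduced.\<close>

lemma integral_fracI:
  assumes "coprime v (int p)"
  shows "integral (of_int u / of_int v)"
proof -
  obtain x y where xy: "quotient_of (of_int u / of_int v) = (x, y)"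
    by (metis surj_pair)
  then have "y > 0" "coprime x y" and eq: "of_int u / of_int v = (of_int x / of_int y :: rat)"
    using quotient_of_denom_pos quotient_of_coprime quotient_of_div by blast+
  have "v \<noteq> 0" using assms prime by auto
  then have "(of_int (u * y) :: rat) = of_int (x * v)" 
    using eq \<open>y > 0\<close> by (simp add: field_simps)
  then have "u * y = x * v" by (simp only: of_int_eq_iff)
  then have "y dvd x * v" by (metis dvd_triv_right)
  then have "y dvd v"
    using \<open>coprime x y\<close> coprime_dvd_mult_right_iff[of y x v] by (simp add: coprime_commute)
  then show ?thesis
    using xy coprime_divisors[OF _ dvd_refl assms] by (simp add: integral_def)
qed

lemma integralE:
  assumes "integral r"
  obtains u v where "r = of_int u / of_int v" "coprime v (int p)" "v \<noteq> 0"
  using that[of "fst (quotient_of r)" "snd (quotient_of r)"] assms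
    quotient_of_div[of r "fst (quotient_of r)" "snd (quotient_of r)"] quotient_of_denom_pos'[of r]
  by (auto simp: integral_def)

lemma integral_of_int [simp]: "integral (of_int u)"
  using integral_fracI[of 1 u] by simp

lemma integral_of_nat [simp]: "integral (of_nat u)"
  using integral_of_int[of "int u"] by simp

lemma integral_numeral [simp]: "integral (numeral u)"
  using integral_of_int[of "numeral u"] by simp

lemma integral_0 [simp]: "integral 0" and integral_1 [simp]: "integral 1"
  using integral_of_int[of 0] integral_of_int[of 1] by simp_all

lemma integral_add [simp]: "integral r \<Longrightarrow> integral s \<Longrightarrow> integral (r + s)"
proof (elim integralE)
  fix u v u' v' assume *: "r = of_int u / of_int v" "coprime v (int p)" "v \<noteq> 0"
    "s = of_int u' / of_int v'" "coprime v' (int p)" "v' \<noteq> 0"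
  then have "r + s = of_int (u * v' + u' * v) / of_int (v * v')"
    by (simp add: field_simps)
  then show "integral (r + s)" using * by (simp add: integral_fracI del: of_int_mult of_int_add)
qed

lemma integral_mult [simp]: "integral r \<Longrightarrow> integral s \<Longrightarrow> integral (r * s)"
proof (elim integralE)
  fix u v u' v' assume *: "r = of_int u / of_int v" "coprime v (int p)" "v \<noteq> 0"
    "s = of_int u' / of_int v'" "coprime v' (int p)" "v' \<noteq> 0"
  then have "r * s = of_int (u * u') / of_int (v * v')"
    by simp
  then show "integral (r * s)" using * by (simp add: integral_fracI del: of_int_mult)
qed

lemma integral_minus [simp]: "integral r \<Longrightarrow> integral (- r)"
  using integral_mult[of "-1" r] integral_of_int[of "-1"] by simp

lemma integral_diff [simp]: "integral r \<Longrightarrow> integral s \<Longrightarrow> integral (r - s)"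
  using integral_add[of r "- s"] by simp

lemma integral_power [simp]: "integral r \<Longrightarrow> integral (r ^ m)"
  by (induction m) auto

lemma integral_sum [intro]: "(\<And>i. i \<in> A \<Longrightarrow> integral (f i)) \<Longrightarrow> integral (sum f A)"
  by (induction A rule: infinite_finite_induct) auto

lemma integral_inverse: 
  assumes "integral r" "\<not> p dvd m"
  shows "integral (r / of_nat m)"
proof -
  have "coprime (int m) (int p)"
    using prime_imp_coprime[OF prime assms(2)] by (simp add: coprime_commute)
  then have "integral (1 / of_nat m)" using integral_fracI[of "int m" 1] by simp
  from integral_mult[OF assms(1) this] show ?thesis by simp
qed

text \<open>Integrality is demanded of the quotient \<open>(r - s) / p^e\<close> alone, so that the
  integrality of one side can be inferred from that of the other.\<close>

definition pcong :: "nat \<Rightarrow> rat \<Rightarrow> rat \<Rightarrow> bool" where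
  "pcong e r s \<longleftrightarrow> (\<exists>t. integral t \<and> r = s + of_nat p ^ e * t)"

lemma pcongI: "integral t \<Longrightarrow> r = s + of_nat p ^ e * t \<Longrightarrow> pcong e r s"
  by (auto simp: pcong_def)

lemma pcongE:
  assumes "pcong e r s"
  obtains t where "integral t" "r = s + of_nat p ^ e * t"
  using assms by (auto simp: pcong_def)

lemma pcong_refl [simp]: "pcong e r r"
  by (rule pcongI[of 0]) auto

lemma pcong_sym: "pcong e r s \<Longrightarrow> pcong e s r"
  by (elim pcongE, rule_tac t = "- t" in pcongI) auto

lemma pcong_trans [trans]:
  assumes "pcong e r s" "pcong e s u" shows "pcong e r u"
proof -
  obtain x y where "integral x" "r = s + of_nat p ^ e * x" "integral y" "s = u + of_nat p ^ e * y"
    using assms by (metis pcongE)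
  then show ?thesis by (intro pcongI[of "x + y"]) (auto simp: algebra_simps)
qed

lemma pcong_add:
  assumes "pcong e r s" "pcong e r' s'" shows "pcong e (r + r') (s + s')"
proof -
  obtain x y where "integral x" "r = s + of_nat p ^ e * x" "integral y" "r' = s' + of_nat p ^ e * y"
    using assms by (metis pcongE)
  then show ?thesis by (intro pcongI[of "x + y"]) (auto simp: algebra_simps)
qed

lemma pcong_mult_left:
  assumes "pcong e r s" "integral c" shows "pcong e (c * r) (c * s)"
proof -
  obtain x where "integral x" "r = s + of_nat p ^ e * x"
    using assms by (auto simp: pcong_def)
  with assms show ?thesis by (intro pcongI[of "c * x"]) (auto simp: algebra_simps)
qed

text \<open>By \<open>r * r' - s * s' = (r - s) * r' + s * (r' - s')\<close>, integrality is asked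
  of \<open>r'\<close> and \<open>s\<close>.\<close>

lemma pcong_mult:
  assumes "pcong e r s" "pcong e r' s'" "integral r'" "integral s" shows "pcong e (r * r') (s * s')"
  using pcong_trans[OF pcong_mult_left[OF assms(1,3)]] pcong_mult_left[OF assms(2,4)]
  by (simp add: mult.commute)

lemma pcong_diff:
  assumes "pcong e r s" "pcong e r' s'" shows "pcong e (r - r') (s - s')"
  using pcong_add[OF assms(1) pcong_mult_left[OF assms(2), of "-1"]] by simp

lemma pcong_p_mult:
  assumes "pcong e r s" shows "pcong (Suc e) (of_nat p * r) (of_nat p * s)"
  using assms by (auto simp: pcong_def algebra_simps)

lemma pcong_sum:
  assumes "\<And>i. i \<in> A \<Longrightarrow> pcong e (f i) (g i)" shows "pcong e (sum f A) (sum g A)"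
  using assms by (induction A rule: infinite_finite_induct) (auto intro: pcong_add)

lemma pcong_prod_one_minus:
  fixes m :: nat
  assumes "\<And>i. i < m \<Longrightarrow> integral (x i)"
  shows "pcong 2 (\<Prod>i<m. 1 - of_nat p * x i) (1 - of_nat p * (\<Sum>i<m. x i))"
  using assms
proof (induction m)
  case (Suc m)
  have *: "integral (\<Sum>i<m. x i)" "integral (x m)" using Suc.prems by auto
  have "pcong 2 (\<Prod>i<Suc m. 1 - of_nat p * x i) ((1 - of_nat p * (\<Sum>i<m. x i)) * (1 - of_nat p * x m))"
    using pcong_mult[OF Suc.IH, of "1 - of_nat p * x m" "1 - of_nat p * x m"] Suc.prems * by simp
  also have "pcong 2 \<dots> (1 - of_nat p * (\<Sum>i<Suc m. x i))"
    \<comment> \<open>The witness is the coefficient of \<open>p^2\<close> in the product of the two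
      factors.\<close>
    using * by (intro pcongI[of "(\<Sum>i<m. x i) * x m"]) (auto simp: power2_eq_square algebra_simps)
  finally show ?case .
qed simp

lemma integral_harmonic: "m < p \<Longrightarrow> integral (harmonic m)"
  unfolding harmonic_def by (intro integral_sum integral_inverse nat_dvd_not_less) auto

text \<open>Passes from witnesses to numerators in lowest terms: clearing denominators leaves a
  factor \<open>v\<close> prime to \<open>p\<close>, which cancels from the divisibility by
  \<open>p^2\<close>.\<close>

lemma rat_cong_p2I:
  assumes "pcong 2 r s" "integral r" "integral s"
  shows "rat_cong_p2 p r s"
proof -
  obtain t where t: "integral t" "r = s + of_nat p ^ 2 * t"
    using assms(1) by (rule pcongE)
  obtain u v where uv: "t = of_int u / of_int v" "coprime v (int p)" "v \<noteq> 0"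
    using t(1) by (rule integralE)
  obtain x y where xy: "quotient_of (r - s) = (x, y)"
    by (metis surj_pair)
  then have "y > 0" and eq: "r - s = (of_int x / of_int y :: rat)"
    using quotient_of_denom_pos quotient_of_div by blast+
  then have "of_int x / of_int y = (of_nat p ^ 2 * (of_int u / of_int v) :: rat)"
    using uv(1) t(2) by simp
  then have "(of_int (x * v) :: rat) = of_int ((int p)^2 * (u * y))"
    using uv(3) \<open>y > 0\<close> by (simp add: field_simps)
  then have "x * v = (int p)^2 * (u * y)" by (simp only: of_int_eq_iff)
  then have "(int p)^2 dvd x * v" by simp
  then have "(int p)^2 dvd x"
    using uv(2) coprime_dvd_mult_left_iff[of "(int p)^2" v x] by (simp add: coprime_commute)
  with xy assms show ?thesis by (simp add: rat_cong_p2_def integral_def)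
qed

end

section \<open>The congruence of coefficients\<close>

locale odd_localization = localization +
  fixes n :: nat
  assumes p_eq: "p = 2 * n + 1"
begin

lemma integral_harmonic_le [simp]: "m \<le> 2 * n \<Longrightarrow> integral (harmonic m)"
  by (rule integral_harmonic) (simp add: p_eq)

lemma not_p_dvd: "0 < m \<Longrightarrow> m \<le> 2 * n \<Longrightarrow> \<not> p dvd m"
  by (rule nat_dvd_not_less) (simp_all add: p_eq)

lemma integral_sign [simp]: "integral ((- 1) ^ m)"
  by (intro integral_power integral_minus integral_1)

lemma of_nat_p: "of_nat p = (2 * of_nat n + 1 :: rat)"
  by (simp add: p_eq)

text \<open>Each factor of the numerator is
  \<open>p - (k + i + 1) = - (k + i + 1) * (1 - p / (k + i + 1))\<close>.\<close>

lemma binomial_reflection: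
  assumes "k + m < p"
  shows "of_nat ((p - 1 - k) choose m) =
    (- 1) ^ m * of_nat ((m + k) choose m) * (\<Prod>i<m. 1 - of_nat p * (1 / of_nat (k + Suc i)) :: rat)"
  using assms
proof (induction m)
  case (Suc m)
  define f g s :: rat where "f = 1 - of_nat p * (1 / of_nat (k + Suc m))"
    and "g = of_nat (Suc (m + k))" and "s = of_nat (Suc m)"
  have "of_nat (p - 1 - k - m) = - g * f"
    using Suc.prems by (simp add: f_def g_def of_nat_diff field_simps)
  then have "of_nat ((p - 1 - k) choose Suc m) = - g * f / s * of_nat ((p - 1 - k) choose m)"
    unfolding of_nat_binomial_Suc s_def by simp
  also have "of_nat ((p - 1 - k) choose m) =
      (- 1) ^ m * of_nat ((m + k) choose m) * (\<Prod>i<m. 1 - of_nat p * (1 / of_nat (k + Suc i)) :: rat)"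
    using Suc by simp
  also have "- g * f / s * \<dots> = (- 1) ^ Suc m * (g / s * of_nat ((m + k) choose m)) *
      ((\<Prod>i<m. 1 - of_nat p * (1 / of_nat (k + Suc i))) * f)"
    by simp
  also have "g / s * of_nat ((m + k) choose m) = of_nat ((Suc m + k) choose Suc m)"
    unfolding add_Suc of_nat_Suc_binomial_Suc g_def s_def ..
  finally show ?case unfolding f_def by (simp only: prod.lessThan_Suc)
qed simp

lemma binomial_reflection_cong:
  assumes "k + m < p"
  shows "pcong 2 (of_nat ((p - 1 - k) choose m))
    ((- 1) ^ m * of_nat ((m + k) choose m) * (1 - of_nat p * (harmonic (k + m) - harmonic k)))"
  unfolding binomial_reflection[OF assms] harmonic_diff
  using assms by (intro pcong_mult_left pcong_prod_one_minus integral_inverse nat_dvd_not_less) auto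

lemma binomial_p_minus_1_cong:
  assumes "k < p"
  shows "pcong 2 (of_nat ((p - 1) choose k)) ((- 1) ^ k * (1 - of_nat p * harmonic k))"
  using binomial_reflection_cong[of 0 k] assms by simp

section \<open>Central binomial coefficients and powers of 16 modulo \<open>p^2\<close>\<close>

lemma of_nat_central_binomial_Suc:
  "of_nat ((2 * Suc k) choose Suc k) = 2 * of_nat (2 * k + 1) / of_nat (Suc k) * (of_nat ((2 * k) choose k) :: rat)"
proof -
  have "of_nat (Suc k) * of_nat (Suc (2 * k) choose k) = of_nat (2 * k + 1) * (of_nat ((2 * k) choose k) :: rat)"
    using binomial_absorb_comp[of "Suc (2 * k)" k] unfolding of_nat_mult[symmetric] of_nat_eq_iff by simp
  then have "of_nat (Suc (2 * k) choose k) = of_nat (2 * k + 1) / of_nat (Suc k) * (of_nat ((2 * k) choose k) :: rat)"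
    by (simp add: field_simps del: of_nat_Suc)
  then have "of_nat (Suc (Suc (2 * k)) choose Suc k) =
      of_nat (Suc (Suc (2 * k))) / of_nat (Suc k) * (of_nat (2 * k + 1) / of_nat (Suc k) * (of_nat ((2 * k) choose k) :: rat))"
    unfolding of_nat_Suc_binomial_Suc[of "Suc (2 * k)" k] by (simp only:)
  also have "of_nat (Suc (Suc (2 * k))) / of_nat (Suc k) = (2 :: rat)"
    by (simp add: field_simps)
  finally show ?thesis by (simp only: mult_Suc_right add_2_eq_Suc times_divide_eq_left times_divide_eq_right mult.assoc)
qed

text \<open>Consecutive terms have ratios \<open>(2k + 1)^2 / (2k + 2)^2\<close> on the left and
  \<open>- (n - k) (n + k + 1) / (k + 1)^2\<close> on the right. As
  \<open>4 (n - k) (n + k + 1) = p^2 - (2k + 1)^2\<close>, the ratios agree modulo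
  \<open>p^2\<close>.\<close>

lemma central_binomial_square_cong:
  assumes "k \<le> n"
  shows "pcong 2 ((of_nat ((2 * k) choose k))\<^sup>2 / 16 ^ k)
    ((- 1) ^ k * of_nat (n choose k) * of_nat ((n + k) choose k))"
  using assms
proof (induction k)
  case (Suc k)
  define A B :: "nat \<Rightarrow> rat" where "A k = (of_nat ((2 * k) choose k))\<^sup>2 / 16 ^ k"
    and "B k = (- 1) ^ k * of_nat (n choose k) * of_nat ((n + k) choose k)" for k
  define q :: rat where "q = of_nat (2 * Suc k)"
  have q: "q \<noteq> 0" "of_nat (Suc k) = q / 2" by (simp_all add: q_def)
  have A: "A (Suc k) = A k * ((of_nat (2 * k + 1))\<^sup>2 / q\<^sup>2)"
    unfolding A_def of_nat_central_binomial_Suc q(2)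
    by (simp add: power_mult_distrib power_divide mult.commute del: of_nat_add of_nat_mult of_nat_Suc)
  have "B (Suc k) = B k * (- (of_nat (n - k) * of_nat (Suc (n + k)) / (q / 2)\<^sup>2))"
    unfolding B_def add_Suc_right of_nat_Suc_binomial_Suc unfolding of_nat_binomial_Suc q(2)
    by (simp add: power2_eq_square del: of_nat_Suc)
  also have "of_nat (n - k) * of_nat (Suc (n + k)) = ((of_nat p)\<^sup>2 - (of_nat (2 * k + 1))\<^sup>2) / (4 :: rat)"
    using Suc.prems by (simp add: of_nat_p of_nat_diff power2_eq_square field_simps)
  also have "- (((of_nat p)\<^sup>2 - (of_nat (2 * k + 1))\<^sup>2) / 4 / (q / 2)\<^sup>2) =
      (of_nat (2 * k + 1))\<^sup>2 / q\<^sup>2 - (of_nat p)\<^sup>2 * (1 / q\<^sup>2)"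
    using q(1) by (simp add: field_simps power2_eq_square)
  finally have B: "B (Suc k) = B k * ((of_nat (2 * k + 1))\<^sup>2 / q\<^sup>2 - (of_nat p)\<^sup>2 * (1 / q\<^sup>2))" .
  have "\<not> p dvd 2 * Suc k"
    using Suc.prems by (intro not_p_dvd) auto
  then have int: "integral (r / q\<^sup>2)" if "integral r" for r
    using that unfolding power2_eq_square divide_divide_eq_left[symmetric] q_def by (intro integral_inverse)
  have "pcong 2 (A (Suc k)) (B k * ((of_nat (2 * k + 1))\<^sup>2 / q\<^sup>2))"
    unfolding A using Suc unfolding A_def B_def by (intro pcong_mult int) auto
  also have "pcong 2 \<dots> (B (Suc k))"
    unfolding B by (intro pcong_mult_left pcongI[of "1 / q\<^sup>2"] int) (simp_all add: B_def)
  finally show ?case unfolding A_def B_def .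
qed simp

text \<open>Compares the two congruences for \<open>(2 n) choose n = (p - 1) choose n\<close>.\<close>

lemma pcong_16_power: "pcong 2 (16 ^ n) (1 - of_nat p * harmonic n)"
proof -
  define c h e :: rat where "c = of_nat ((2 * n) choose n)" and "h = of_nat p * harmonic n" and "e = (- 1) ^ n"
  have int: "integral c" "integral h" "integral e"
    by (simp_all add: c_def h_def e_def)
  have e: "e * (e * r) = r" for r by (simp add: e_def mult.assoc[symmetric] flip: power_mult_distrib)
  have e1: "e * e = 1" using e[of 1] by simp
  \<comment> \<open>\<open>d\<close> inverts \<open>c\<close> modulo \<open>p^2\<close>, since
    \<open>c\<close> is congruent to \<open>e * (1 - h)\<close> and \<open>p^2\<close> divides
    \<open>h^2\<close>.\<close>
  define d where "d = e * (1 + h)"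
  have d: "integral d" using int by (simp add: d_def)
  have sq: "pcong 2 ((1 + h) * (1 - h)) 1"
    by (intro pcongI[of "- (harmonic n)\<^sup>2"]) (auto simp: h_def algebra_simps power2_eq_square)
  have "pcong 2 c (e * (1 - h))"
    using binomial_p_minus_1_cong[of n] p_eq by (simp add: c_def e_def h_def)
  from pcong_mult_left[OF this d] have "pcong 2 (d * c) ((1 + h) * (1 - h))"
    by (simp add: d_def algebra_simps e1 e)
  then have dc: "pcong 2 (d * c) 1" using sq pcong_trans by blast
  have "pcong 2 (c\<^sup>2 / 16 ^ n) (e * c)"
    using central_binomial_square_cong[of n] by (simp add: c_def e_def mult_2)
  \<comment> \<open>The factor \<open>16 ^ n * d^2\<close> clears the denominator and cancels
    \<open>c\<close> on both sides, leaving \<open>16 ^ n * e * d\<close> congruent to 1.\<close>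
  from pcong_mult_left[OF this, of "16 ^ n * d\<^sup>2"] d
  have "pcong 2 ((d * c) * (d * c)) ((16 ^ n * e * d) * (d * c))"
    by (simp add: power2_eq_square mult_ac)
  moreover have "pcong 2 ((d * c) * (d * c)) 1"
    using pcong_mult[OF dc dc] d int by simp
  moreover have "pcong 2 ((16 ^ n * e * d) * (d * c)) (16 ^ n * e * d)"
    using pcong_mult_left[OF dc, of "16 ^ n * e * d"] d int by simp
  ultimately have "pcong 2 (16 ^ n * e * d) 1"
    using pcong_sym pcong_trans by blast
  then have "pcong 2 (16 ^ n * (1 + h)) 1"
    by (simp add: d_def mult.assoc e)
  \<comment> \<open>\<open>1 - h\<close> is the inverse of \<open>1 + h\<close> modulo
    \<open>p^2\<close>.\<close>
  from pcong_mult_left[OF this, of "1 - h"] int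
  have "pcong 2 (16 ^ n * ((1 + h) * (1 - h))) (1 - h)" by (simp add: mult_ac)
  moreover have "pcong 2 (16 ^ n * ((1 + h) * (1 - h))) (16 ^ n)"
    using pcong_mult_left[OF sq, of "16 ^ n"] by simp
  ultimately show ?thesis unfolding h_def using pcong_sym pcong_trans by blast
qed

lemma pcong_16_power_p_minus_1: "pcong 2 (16 ^ (p - 1)) (1 - of_nat p * (2 * harmonic n))"
proof -
  have "pcong 2 (16 ^ n * 16 ^ n) ((1 - of_nat p * harmonic n) * (1 - of_nat p * harmonic n))"
    by (intro pcong_mult pcong_16_power) auto
  also have "pcong 2 \<dots> (1 - of_nat p * (2 * harmonic n))"
    by (intro pcongI[of "(harmonic n)\<^sup>2"]) (auto simp: algebra_simps power2_eq_square)
  also have "16 ^ n * 16 ^ n = (16 ^ (p - 1) :: rat)"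
    unfolding p_eq power_add[symmetric] by (simp add: mult_2)
  finally show ?thesis .
qed

section \<open>Harmonic numbers modulo \<open>p\<close>\<close>

lemma harmonic_reflection:
  assumes "k \<le> n"
  shows "pcong 1 (harmonic (n + k)) (harmonic (n - k))"
  using assms
proof (induction k)
  case (Suc k)
  \<comment> \<open>The new terms of the two harmonic numbers have denominators with sum
    \<open>p\<close>, so their reciprocals cancel modulo \<open>p\<close>.\<close>
  define x y :: rat where "x = of_nat (Suc (n + k))" and "y = of_nat (n - k)"
  have nz: "x \<noteq> 0" "y \<noteq> 0" "x + y = of_nat p"
    using Suc.prems by (auto simp: x_def y_def p_eq of_nat_diff)
  have *: "integral (1 / x / y)"
    unfolding x_def y_def using Suc.prems by (intro integral_inverse not_p_dvd) auto
  have "Suc (n - Suc k) = n - k" using Suc.prems by simp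
  then have "harmonic (n - k) = harmonic (n - Suc k) + 1 / y"
    using harmonic_Suc[of "n - Suc k"] by (simp add: y_def)
  moreover have "harmonic (n + Suc k) = harmonic (n + k) + 1 / x"
    by (simp add: harmonic_Suc x_def)
  moreover have "1 / x + 1 / y = of_nat p * (1 / x / y)"
    using nz by (simp add: field_simps)
  ultimately show ?case
    using pcong_add[OF Suc.IH, of "1 / x" "1 / x"] Suc.prems
      pcong_trans[OF _ pcongI[OF *, of "harmonic (n - k) + 1 / x" "harmonic (n - Suc k)" 1]]
    by (simp add: add.assoc add.commute[of "1 / y"])
qed simp

text \<open>Raising \<open>j\<close> by one adds \<open>2 / (2j + 1) + 1 / (j + 1)\<close> on the
  left. Modulo \<open>p\<close>, the first summand is \<open>1 / (n + j + 1)\<close>, because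
  \<open>2 (n + j + 1) = 2j + 1 + p\<close>; this builds up \<open>harmonic (n + j)\<close>, which
  is then reflected.\<close>

lemma harmonic_double_cong:
  assumes "j \<le> n"
  shows "pcong 1 (2 * harmonic (2 * j)) (harmonic j + harmonic (n - j) - harmonic n)"
proof -
  have "pcong 1 (2 * harmonic (2 * j)) (harmonic j + harmonic (n + j) - harmonic n)"
    using assms
  proof (induction j)
    case (Suc j)
    define x y :: rat where "x = of_nat (Suc (2 * j))" and "y = of_nat (Suc (n + j))"
    have nz: "x \<noteq> 0" "y \<noteq> 0" "2 * y - x = of_nat p"
      by (auto simp: x_def y_def p_eq simp del: of_nat_Suc) simp
    have *: "integral (1 / x / y)"
      unfolding x_def y_def using Suc.prems by (intro integral_inverse not_p_dvd) auto
    have "2 * harmonic (2 * Suc j) = 2 * harmonic (2 * j) + (2 / x + 1 / of_nat (Suc j))"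
      by (simp add: harmonic_Suc x_def field_simps del: of_nat_Suc) (simp add: field_simps)
    also have "2 / x = 1 / y + of_nat p * (1 / x / y)"
      using nz(1,2) unfolding nz(3)[symmetric] by (simp add: field_simps)
    finally have "2 * harmonic (2 * Suc j) =
        (2 * harmonic (2 * j) + (1 / y + 1 / of_nat (Suc j))) + of_nat p ^ 1 * (1 / x / y)"
      by simp
    then have "pcong 1 (2 * harmonic (2 * Suc j)) (2 * harmonic (2 * j) + (1 / y + 1 / of_nat (Suc j)))"
      by (rule pcongI[OF *])
    also have "pcong 1 \<dots> (harmonic j + harmonic (n + j) - harmonic n + (1 / y + 1 / of_nat (Suc j)))"
      using Suc by (intro pcong_add) auto
    also have "\<dots> = harmonic (Suc j) + harmonic (n + Suc j) - harmonic n"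
      by (simp add: harmonic_Suc y_def)
    finally show ?case .
  qed simp
  also have "pcong 1 \<dots> (harmonic j + harmonic (n - j) - harmonic n)"
    using harmonic_reflection[OF assms] by (intro pcong_diff pcong_add) auto
  finally show ?thesis .
qed

section \<open>Comparison of the coefficients of \<open>x^k\<close> modulo
  \<open>p^2\<close>\<close>

lemma binomial_sum_cong:
  assumes "k \<le> n"
  shows "pcong 2
    (\<Sum>j\<le>n. of_nat ((n choose j) * ((n - k) choose (n - j))) * (1 + 2 * of_nat p * harmonic (2 * j)))
    ((- 1) ^ n * of_nat ((n + k) choose k) * (1 + of_nat p * (2 * harmonic n - harmonic k)))"
proof -
  define w :: "nat \<Rightarrow> rat" where "w j = of_nat ((n choose j) * ((n - k) choose (n - j)))" for j
  define W :: rat where "W = of_nat ((2 * n - k) choose n)"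
  define C :: rat where "C = (- 1) ^ n * of_nat ((n + k) choose k)"
  define x y z where "x = harmonic n" and "y = harmonic k" and "z = harmonic (n - k)"
  have int: "integral W" "integral C" "integral x" "integral y" "integral z" "\<And>j. integral (w j)"
    using assms by (simp_all add: W_def C_def w_def x_def y_def z_def)
  have sum_w: "(\<Sum>j\<le>n. w j) = W"
    using vandermonde[of n "n - k" n] assms unfolding w_def W_def of_nat_sum[symmetric] by (simp add: mult_2)
  \<comment> \<open>In the claim this sum is multiplied by \<open>p\<close>, so its value modulo
    \<open>p\<close> suffices.\<close>
  have "pcong 1 (\<Sum>j\<le>n. w j * (2 * harmonic (2 * j)))
      (\<Sum>j\<le>n. w j * (harmonic j + harmonic (n - j) - harmonic n))"
    using int by (intro pcong_sum pcong_mult_left harmonic_double_cong) auto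
  also have "\<dots> = (\<Sum>j\<le>n. w j * (harmonic j + harmonic (n - j))) - (\<Sum>j\<le>n. w j) * harmonic n"
    by (simp add: algebra_simps sum_subtractf sum_distrib_left)
  also have "\<dots> = W * (2 * x + z - 2 * harmonic (2 * n - k))"
    unfolding sum_w using Vandermonde_harmonic_sum[OF assms]
    by (simp add: w_def W_def x_def z_def algebra_simps)
  also have "pcong 1 \<dots> (W * (2 * x + z - 2 * y))"
  proof (intro pcong_mult_left pcong_diff)
    have "n + (n - k) = 2 * n - k" "n - (n - k) = k" using assms by auto
    then show "pcong 1 (harmonic (2 * n - k)) y"
      using harmonic_reflection[of "n - k"] by (simp add: y_def)
  qed (use int in auto)
  finally have "pcong 2 (of_nat p * (\<Sum>j\<le>n. w j * (2 * harmonic (2 * j)))) (of_nat p * (W * (2 * x + z - 2 * y)))"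
    using pcong_p_mult[of 1] by (simp add: numeral_2_eq_2)
  from pcong_add[OF pcong_refl[of _ W] this]
  have "pcong 2 (\<Sum>j\<le>n. w j * (1 + 2 * of_nat p * harmonic (2 * j))) (W * (1 + of_nat p * (2 * x + z - 2 * y)))"
    unfolding sum_w[symmetric] by (simp add: algebra_simps sum.distrib sum_distrib_left)
  \<comment> \<open>\<open>W\<close> is \<open>(p - 1 - k) choose n\<close>, to which the reflection
    of binomial coefficients applies; \<open>harmonic (n + k)\<close> may be replaced by
    \<open>z\<close> because it is multiplied by \<open>p\<close>.\<close>
  also have "pcong 2 \<dots> (C * (1 - of_nat p * (z - y)) * (1 + of_nat p * (2 * x + z - 2 * y)))"
  proof (intro pcong_mult)
    have "pcong 2 W (C * (1 - of_nat p * (harmonic (n + k) - y)))"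
      using binomial_reflection_cong[of k n] assms p_eq binomial_symmetric[of k "n + k"]
      by (simp add: W_def C_def y_def add.commute[of k n])
    also have "pcong 2 \<dots> (C * (1 - of_nat p * (z - y)))"
      unfolding z_def numeral_2_eq_2 using int harmonic_reflection[OF assms]
      by (intro pcong_mult_left[OF pcong_diff[OF pcong_refl pcong_p_mult[OF pcong_diff[OF _ pcong_refl]]]]) simp_all
    finally show "pcong 2 W (C * (1 - of_nat p * (z - y)))" .
  qed (use int in auto)
  \<comment> \<open>In the part linear in \<open>p\<close> the two occurrences of \<open>z\<close>
    cancel; the witness is the \<open>p^2\<close> term.\<close>
  also have "pcong 2 \<dots> (C * (1 + of_nat p * (2 * x - y)))"
    using int by (intro pcongI[of "- C * (z - y) * (2 * x + z - 2 * y)"])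
      (auto simp: algebra_simps power2_eq_square)
  finally show ?thesis by (simp add: w_def C_def x_def y_def)
qed

lemma coefficient_cong:
  assumes "k \<le> n"
  shows "pcong 2 (of_nat ((p - 1) choose k) * (of_nat ((2 * k) choose k))\<^sup>2 / 16 ^ k)
    ((- 1) ^ n * 16 ^ (p - 1) *
      (\<Sum>j\<le>n. (of_nat (n choose j))\<^sup>2 * of_nat (j choose k) * (1 + 2 * of_nat p * harmonic (2 * j))))"
    (is "pcong 2 _ (_ * ?S)")
proof -
  define C :: rat where "C = of_nat (n choose k) * of_nat ((n + k) choose k)"
  define x y where "x = harmonic n" and "y = harmonic k"
  have int: "integral C" "integral x" "integral y"
    using assms by (simp_all add: C_def x_def y_def)
  have "k < p" using assms p_eq by simp
  \<comment> \<open>Integrality is read off from the congruence with an integral right-hand side,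
    without treating \<open>16 ^ k\<close> separately.\<close>
  have int_sq: "integral ((of_nat ((2 * k) choose k))\<^sup>2 / 16 ^ k)"
    using central_binomial_square_cong[OF assms] by (elim pcongE) auto
  \<comment> \<open>Trinomial revision on one of the two factors \<open>n choose j\<close>; for
    \<open>j < k\<close> both sides vanish. The other factor stays for the Vandermonde-type
    sum.\<close>
  have "(n choose j) * (j choose k) = (n choose k) * ((n - k) choose (n - j))" if "j \<le> n" for j
    using choose_mult[of k j n] binomial_symmetric[of "j - k" "n - k"] that by (cases "k \<le> j") (auto simp: binomial_eq_0)
  then have "(of_nat (n choose j))\<^sup>2 * of_nat (j choose k) =
      of_nat (n choose k) * (of_nat ((n choose j) * ((n - k) choose (n - j))) :: rat)" if "j \<le> n" for j
    using that by (simp add: power2_eq_square mult_ac flip: of_nat_mult)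
  then have S: "?S = of_nat (n choose k) *
      (\<Sum>j\<le>n. of_nat ((n choose j) * ((n - k) choose (n - j))) * (1 + 2 * of_nat p * harmonic (2 * j)))"
    by (simp add: sum_distrib_left mult.assoc)
  have "pcong 2 ?S (of_nat (n choose k) *
      ((- 1) ^ n * of_nat ((n + k) choose k) * (1 + of_nat p * (2 * harmonic n - harmonic k))))"
    unfolding S using assms by (intro pcong_mult_left binomial_sum_cong) auto
  also have "\<dots> = (- 1) ^ n * C * (1 + of_nat p * (2 * x - y))"
    by (simp add: C_def x_def y_def)
  finally have "pcong 2 ((- 1) ^ n * 16 ^ (p - 1) * ?S)
      ((- 1) ^ n * (1 - of_nat p * (2 * x)) * ((- 1) ^ n * C * (1 + of_nat p * (2 * x - y))))"
    using int pcong_16_power_p_minus_1 unfolding x_def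
    by (intro pcong_mult pcong_mult_left integral_mult integral_sum) auto
  also have "\<dots> = C * ((1 - of_nat p * (2 * x)) * (1 + of_nat p * (2 * x - y)))"
    by (simp flip: power_mult_distrib add: power_minus1_even mult_ac)
  \<comment> \<open>The power of 16 contributes \<open>- 2 p H_n\<close>, cancelling the term
    \<open>2 p H_n\<close> from the sum.\<close>
  also have "pcong 2 \<dots> (C * (1 - of_nat p * y))"
    using int by (intro pcongI[of "- C * (2 * x) * (2 * x - y)"]) (auto simp: algebra_simps power2_eq_square)
  finally have right: "pcong 2 ((- 1) ^ n * 16 ^ (p - 1) * ?S) (C * (1 - of_nat p * y))" .
  have "pcong 2 (of_nat ((p - 1) choose k) * ((of_nat ((2 * k) choose k))\<^sup>2 / 16 ^ k))
      ((- 1) ^ k * (1 - of_nat p * y) * ((- 1) ^ k * of_nat (n choose k) * of_nat ((n + k) choose k)))"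
    using assms int int_sq \<open>k < p\<close> unfolding y_def
    by (intro pcong_mult binomial_p_minus_1_cong central_binomial_square_cong) auto
  also have "\<dots> = C * (1 - of_nat p * y)"
    by (simp add: C_def mult_ac flip: power_mult_distrib)
  finally show ?thesis
    unfolding times_divide_eq_right by (rule pcong_trans) (rule pcong_sym[OF right])
qed

text \<open>Linearity in \<open>f\<close>: swapping the two sums on the right leaves the coefficient
  of each \<open>f k\<close>, where \<open>coefficient_cong\<close> applies. Both Lucas sequences
  are instances.\<close>

lemma binomial_transform_cong:
  fixes f g :: "nat \<Rightarrow> int"
  assumes g: "\<And>j. g j = (\<Sum>k\<le>j. of_nat (j choose k) * f k)"
  shows "rat_cong_p2 p
    (\<Sum>k = 0..n. of_nat ((p - 1) choose k) * (of_nat ((2 * k) choose k))\<^sup>2 * of_int (f k) / 16 ^ k)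
    ((- 1) ^ n * 16 ^ (p - 1) *
      (\<Sum>j = 0..n. (of_nat (n choose j))\<^sup>2 * of_int (g j) * (1 + 2 * of_nat p * harmonic (2 * j))))"
    (is "rat_cong_p2 p ?L ?R")
proof -
  define t :: "nat \<Rightarrow> rat" where
    "t k = of_nat ((p - 1) choose k) * (of_nat ((2 * k) choose k))\<^sup>2 / 16 ^ k" for k
  define u :: "nat \<Rightarrow> rat" where
    "u j = (of_nat (n choose j))\<^sup>2 * (1 + 2 * of_nat p * harmonic (2 * j))" for j
  have L: "?L = (\<Sum>k\<le>n. of_int (f k) * t k)"
    unfolding atMost_atLeast0 t_def by (intro sum.cong) simp_all
  \<comment> \<open>A common upper limit \<open>n\<close> permits the swap; the added terms have
    \<open>k > j\<close> and vanish.\<close>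
  have g': "of_int (g j) = (\<Sum>k\<le>n. of_nat (j choose k) * of_int (f k) :: rat)" if "j \<le> n" for j
    unfolding g using that by (simp, intro sum.mono_neutral_left) auto
  have "?R = (- 1) ^ n * 16 ^ (p - 1) * (\<Sum>j\<le>n. \<Sum>k\<le>n. of_int (f k) * (of_nat (j choose k) * u j))"
    unfolding atMost_atLeast0[symmetric] u_def
    by (intro arg_cong2[of _ _ _ _ "(*)"] sum.cong refl)
      (simp add: g' sum_distrib_left sum_distrib_right mult_ac)
  also have "\<dots> = (\<Sum>k\<le>n. of_int (f k) * ((- 1) ^ n * 16 ^ (p - 1) * (\<Sum>j\<le>n. of_nat (j choose k) * u j)))"
    by (subst sum.swap) (simp add: sum_distrib_left sum_distrib_right mult_ac)
  finally have R: "?R = (\<Sum>k\<le>n. of_int (f k) * ((- 1) ^ n * 16 ^ (p - 1) * (\<Sum>j\<le>n. of_nat (j choose k) * u j)))" .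
  have cong: "pcong 2 ?L ?R"
    unfolding L R using coefficient_cong
    by (intro pcong_sum pcong_mult_left) (auto simp: t_def u_def mult_ac)
  have int: "integral ?R"
    by (intro integral_mult integral_sum) auto
  \<comment> \<open>The right side is visibly integral, and the congruence carries this over to the
    left side with its powers of 16.\<close>
  obtain t where "integral t" "?L = ?R + of_nat p ^ 2 * t"
    using cong by (rule pcongE)
  then have "integral ?L" using int by (simp only: integral_add integral_mult integral_power integral_of_nat)
  then show ?thesis using cong int by (intro rat_cong_p2I)
qed

end

theorem theorem2:
  fixes p :: nat and a b :: int
  assumes "prime p" and "odd p"
  shows
    "rat_cong_p2 p
       (\<Sum>k = 0..(p - 1) div 2.
          of_nat ((p - 1) choose k) * (of_nat ((2 * k) choose k))\<^sup>2
            * of_int (lucas_V a b k) / 16 ^ k)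
       ((- 1) ^ ((p - 1) div 2) * 16 ^ (p - 1) *
        (\<Sum>j = 0..(p - 1) div 2.
          (of_nat (((p - 1) div 2) choose j))\<^sup>2
            * of_int (lucas_V (a + 2) (a + b + 1) j)
            * (1 + 2 * of_nat p * harmonic (2 * j))))
     \<and> (\<not> (int p)\<^sup>2 dvd a\<^sup>2 - 4 * b \<longrightarrow>
        rat_cong_p2 p
       (\<Sum>k = 0..(p - 1) div 2.
          of_nat ((p - 1) choose k) * (of_nat ((2 * k) choose k))\<^sup>2
            * of_int (lucas_U a b k) / 16 ^ k)
       ((- 1) ^ ((p - 1) div 2) * 16 ^ (p - 1) *
        (\<Sum>j = 0..(p - 1) div 2.
          (of_nat (((p - 1) div 2) choose j))\<^sup>2
            * of_int (lucas_U (a + 2) (a + b + 1) j)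
            * (1 + 2 * of_nat p * harmonic (2 * j)))))"
proof -
  have "p = 2 * ((p - 1) div 2) + 1"
    using assms(2) by presburger
  with assms(1) interpret odd_localization p "(p - 1) div 2"
    by unfold_locales
  show ?thesis
    using binomial_transform_cong[OF lucas_V_binomial_transform[of a b]]
      binomial_transform_cong[OF lucas_U_binomial_transform[of a b]] by (intro conjI impI)
qed

end
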